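(* (i) If $A \subseteq \mathbb{N}$ has property $\overline{P}$ or property $\overline{P}_\infty$, then the upper density of $A$ is strictly less than $\frac{6}{\pi^2}$. (ii) Conversely, for any $\varepsilon > 0$ there exists a set $A \subseteq \mathbb{N}$ with property $\overline{P}$ (and hence also $\overline{P}_\infty$) whose lower density is at least $\frac{6}{\pi^2} - \varepsilon$.
   Context: $\mathrm{SF}$ denotes the set of squarefree positive integers. A set $A \subseteq \mathbb{N}$ has property $\overline{P}$ if there are infinitely many $n \in \mathbb{N}$ such that $n + a \in \mathrm{SF}$ for all $a \in A$. $A$ has property $\overline{P}_\infty$ if there are infinitely many $n \in \mathbb{N}$ such that $n + a \in \mathrm{SF}$ for all but finitely many $a \in A$. For $x>0$, $[x] = \{n \in \mathbb{N}: n \le x\}$; the upper and lower densities of $A$ are $\limsup_{x\to\infty}|A\cap[x]|/x$ and $\liminf_{x\to\infty}|A\cap[x]|/x$. *)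

theory Defs
  imports
    Complex_Main
    "HOL-Library.Extended_Real"
    "HOL-Library.Liminf_Limsup"
    "HOL-Computational_Algebra.Squarefree"
begin

text \<open>
  The natural numbers of the source are the positive integers; they are represented by the set
  \<open>Npos\<close> inside the type \<^typ>\<open>nat\<close>.
\<close>

definition Npos :: "nat set" where
  "Npos = {n. 0 < n}"

definition SF :: "nat set" where
  "SF = {n \<in> Npos. squarefree n}"

definition property_Pbar :: "nat set \<Rightarrow> bool" where
  "property_Pbar A \<longleftrightarrow> infinite {n \<in> Npos. \<forall>a\<in>A. n + a \<in> SF}"

definition property_Pbar_inf :: "nat set \<Rightarrow> bool" where
  "property_Pbar_inf A \<longleftrightarrow> infinite {n \<in> Npos. finite {a \<in> A. n + a \<notin> SF}}"

definition initial_segment :: "real \<Rightarrow> nat set" where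
  "initial_segment x = {n \<in> Npos. real n \<le> x}"

text \<open>
  The densities are taken in \<^typ>\<open>ereal\<close>, a complete lattice, so that the limits superior and
  inferior always exist; \<open>x\<close> ranges over the reals.
\<close>

definition upper_density :: "nat set \<Rightarrow> ereal" where
  "upper_density A =
     Limsup at_top (\<lambda>x::real. ereal (real (card (A \<inter> initial_segment x)) / x))"

definition lower_density :: "nat set \<Rightarrow> ereal" where
  "lower_density A =
     Liminf at_top (\<lambda>x::real. ereal (real (card (A \<inter> initial_segment x)) / x))"

end

theory Submission
  imports Defs "HOL-Analysis.Analysis" "HOL-Number_Theory.Number_Theory"
    "HOL-Real_Asymp.Real_Asymp"
begin

text \<open>
  If \<open>m < n\<close> are two shifts admitted by \<open>A\<close>, then up to finitely many elements \<open>A\<close> avoids the class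
  \<open>-m\<close> modulo \<open>p\<^sup>2\<close> for every prime \<open>p\<close>, and for one prime \<open>q > n\<close> also the class \<open>-n\<close> modulo \<open>q\<^sup>2\<close>.
  Sieving by the primes up to \<open>y\<close> bounds the upper density by the partial Euler product of
  \<open>1 / \<zeta>(2) = 6 / \<pi>\<^sup>2\<close> times a fixed factor less than \<open>1\<close>.

  For the converse, call a shift \<open>n\<close> \<open>\<delta>\<close>-good if, for every \<open>x\<close>, at most \<open>\<delta> * x\<close> squarefree \<open>a \<le> x\<close>
  have \<open>n + a\<close> not squarefree. There are arbitrarily large \<open>\<delta>\<close>-good shifts for each \<open>\<delta> > 0\<close>. Choosing
  \<open>\<nu> i > i\<close> good for \<open>\<epsilon> / 2 ^ (i + 2)\<close>, the squarefree \<open>a\<close> with all \<open>\<nu> i + a\<close> squarefree form the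
  required set: uniformity in \<open>x\<close> makes the losses summable.
\<close>

subsection \<open>Sieving by residue classes\<close>

lemma card_residue_conditions:
  fixes q :: "'a \<Rightarrow> nat"
  assumes "finite P" "\<And>p. p \<in> P \<Longrightarrow> q p > 0" "\<And>p. p \<in> P \<Longrightarrow> C p \<subseteq> {..<q p}"
    "\<And>p r. p \<in> P \<Longrightarrow> r \<in> P \<Longrightarrow> p \<noteq> r \<Longrightarrow> coprime (q p) (q r)"
  shows "card {a. a < (\<Prod>p\<in>P. q p) \<and> (\<forall>p\<in>P. a mod q p \<in> C p)} = (\<Prod>p\<in>P. card (C p))"
  using assms
proof (induction P rule: finite_induct)
  case empty
  then show ?case by simp
next
  case (insert x P)
  let ?Q = "\<Prod>p\<in>P. q p"
  let ?T = "{a. a < ?Q \<and> (\<forall>p\<in>P. a mod q p \<in> C p)}"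
  let ?S = "{a. a < q x * ?Q \<and> (\<forall>p\<in>insert x P. a mod q p \<in> C p)}"
  have Q0: "?Q > 0" using insert.prems(1) by (simp add: prod_pos)
  have qx: "q x > 0" using insert.prems(1) by simp
  have cop: "coprime (q x) ?Q"
    using insert.prems(3)[of x] insert.hyps(2) by (intro prod_coprime_right) auto
  have dvdQ: "q p dvd ?Q" if "p \<in> P" for p using that insert.hyps(1) by (rule dvd_prodI[rotated])
  have uniq: "\<exists>!z. z < q x * ?Q \<and> [z = u] (mod q x) \<and> [z = v] (mod ?Q)" for u v
    by (rule binary_chinese_remainder_unique_nat) (use cop qx Q0 in auto)
  have "bij_betw (\<lambda>a. (a mod q x, a mod ?Q)) ?S (C x \<times> ?T)"
    unfolding bij_betw_def
  proof
    show "inj_on (\<lambda>a. (a mod q x, a mod ?Q)) ?S"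
      using uniq by (auto simp: inj_on_def cong_def)
    show "(\<lambda>a. (a mod q x, a mod ?Q)) ` ?S = C x \<times> ?T"
    proof safe
      fix a assume "a < q x * ?Q" "\<forall>p\<in>insert x P. a mod q p \<in> C p"
      then show "a mod q x \<in> C x" "a mod ?Q < ?Q" "\<And>p. p \<in> P \<Longrightarrow> a mod ?Q mod q p \<in> C p"
        using Q0 dvdQ by (auto simp: mod_mod_cancel)
    next
      fix u v assume uv: "u \<in> C x" "v < ?Q" "\<forall>p\<in>P. v mod q p \<in> C p"
      have "u < q x" using insert.prems(2)[of x] uv by auto
      moreover obtain a where a: "a < q x * ?Q" "a mod q x = u mod q x" "a mod ?Q = v mod ?Q"
        using uniq[of u v] by (auto simp: cong_def)
      ultimately have *: "a mod q x = u" "a mod ?Q = v" using uv by auto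
      have "a mod q p \<in> C p" if "p \<in> P" for p
        using uv(3) that *(2) dvdQ[OF that] by (metis mod_mod_cancel)
      then show "(u, v) \<in> (\<lambda>a. (a mod q x, a mod ?Q)) ` ?S"
        using a * uv by (intro image_eqI[of _ _ a]) auto
    qed
  qed
  then have "card ?S = card (C x) * card ?T"
    by (simp only: bij_betw_same_card[of _ ?S "C x \<times> ?T"] card_cartesian_product)
  also have "card ?T = (\<Prod>p\<in>P. card (C p))"
    using insert.prems by (intro insert.IH) auto
  finally show ?case using insert.hyps by simp
qed

text \<open>Each full period contributes the same count \<open>c\<close>, and the incomplete one at
  the end costs at most \<open>c \<le> M\<close>.\<close>

lemma card_periodic:
  fixes S :: "nat set"
  assumes M: "M > 0" and per: "\<And>a. a mod M \<in> S \<longleftrightarrow> a \<in> S"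
  shows "\<bar>real (card (S \<inter> {..<n})) - real n * (real (card (S \<inter> {..<M})) / real M)\<bar> \<le> real M"
proof -
  define c where "c = card (S \<inter> {..<M})"
  have shifts: "a + M * t \<in> S \<longleftrightarrow> a \<in> S" for a t
    using per[of a] per[of "a + M * t"] by simp
  have mult: "card (S \<inter> {..<M * t}) = t * c" for t
  proof (induction t)
    case (Suc t)
    have "S \<inter> {..<M * Suc t} = (S \<inter> {..<M * t}) \<union> (\<lambda>a. a + M * t) ` (S \<inter> {..<M})"
      (is "?L = ?A \<union> ?B")
    proof (intro equalityI subsetI)
      fix a assume a: "a \<in> ?L"
      show "a \<in> ?A \<union> ?B"
      proof (cases "a < M * t")
        case False
        then have "a = (a - M * t) + M * t" by simp
        then show ?thesis using a False shifts[of "a - M * t" t]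
          by (intro UnI2 image_eqI[of _ _ "a - M * t"]) auto
      qed (use a in auto)
    qed (auto simp: shifts)
    moreover have "?A \<inter> ?B = {}" by auto
    ultimately have "card ?L = card ?A + card ?B"
      by (simp add: card_Un_disjoint)
    also have "card ?B = c" unfolding c_def by (intro card_image) (auto simp: inj_on_def)
    finally show ?case using Suc by simp
  qed simp
  define t where "t = n div M"
  have t: "M * t \<le> n" "n < M * (t + 1)"
    unfolding t_def using M by (auto simp: dividend_less_times_div)
  have "card (S \<inter> {..<M * t}) \<le> card (S \<inter> {..<n})"
    using t by (intro card_mono) auto
  moreover have "card (S \<inter> {..<n}) \<le> card (S \<inter> {..<M * (t + 1)})"
    using t by (intro card_mono) auto
  ultimately have b: "t * c \<le> card (S \<inter> {..<n})" "card (S \<inter> {..<n}) \<le> (t + 1) * c"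
    by (simp_all only: mult)
  have cM: "c \<le> M" unfolding c_def using card_mono[of "{..<M}" "S \<inter> {..<M}"] by auto
  have "real t \<le> real n / M" "real n / M \<le> real t + 1"
    using t M by (simp_all add: field_simps flip: of_nat_mult of_nat_add)
  then have "real t * c \<le> real n / M * c" "real n / M * c \<le> (real t + 1) * c"
    by (intro mult_right_mono; simp)+
  moreover have "real t * c \<le> real (card (S \<inter> {..<n}))"
      "real (card (S \<inter> {..<n})) \<le> (real t + 1) * c"
    using b by (simp_all flip: of_nat_mult of_nat_Suc add: add.commute)
  moreover have "(real t + 1) * c \<le> real t * c + M" using cM by (simp add: algebra_simps)
  ultimately show ?thesis
    unfolding c_def[symmetric] by (simp add: abs_le_iff)
qed

text \<open>The conditions are periodic modulo the product of the moduli, and over one period the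
  Chinese remainder count is exact. The error depends on the moduli alone, so for fixed
  \<open>P\<close> it stays bounded as \<open>n\<close> grows.\<close>

lemma card_sieve:
  fixes q :: "'a \<Rightarrow> nat"
  assumes "finite P" "\<And>p. p \<in> P \<Longrightarrow> q p > 0" "\<And>p. p \<in> P \<Longrightarrow> C p \<subseteq> {..<q p}"
    "\<And>p r. p \<in> P \<Longrightarrow> r \<in> P \<Longrightarrow> p \<noteq> r \<Longrightarrow> coprime (q p) (q r)"
  shows "\<bar>real (card {a. a < n \<and> (\<forall>p\<in>P. a mod q p \<in> C p)})
            - real n * (\<Prod>p\<in>P. real (card (C p)) / real (q p))\<bar> \<le> real (\<Prod>p\<in>P. q p)"
proof -
  define S where "S = {a. \<forall>p\<in>P. a mod q p \<in> C p}"
  define M where "M = (\<Prod>p\<in>P. q p)"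
  have "M > 0" unfolding M_def using assms by (simp add: prod_pos)
  have "q p dvd M" if "p \<in> P" for p
    unfolding M_def using that assms(1) by (rule dvd_prodI[rotated])
  then have "a mod M \<in> S \<longleftrightarrow> a \<in> S" for a by (auto simp: S_def mod_mod_cancel)
  moreover have "S \<inter> {..<k} = {a. a < k \<and> (\<forall>p\<in>P. a mod q p \<in> C p)}" for k
    by (auto simp: S_def)
  ultimately show ?thesis
    using card_periodic[OF \<open>M > 0\<close>, of S n] card_residue_conditions[OF assms]
    unfolding M_def by (simp add: prod_dividef)
qed

text \<open>Elements of one class are separated by their quotients by \<open>q\<close>, which lie
  between \<open>0\<close> and \<open>n div q\<close>. The extra \<open>1\<close> is the price for a
  class that may begin anywhere.\<close>

lemma card_congruent_le:
  fixes S :: "nat set"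
  assumes "q > 0" "S \<subseteq> {1..n}" "\<And>a b. a \<in> S \<Longrightarrow> b \<in> S \<Longrightarrow> [a = b] (mod q)"
  shows "real (card S) \<le> real n / real q + 1"
proof -
  have "inj_on (\<lambda>a. a div q) S"
    using assms(3) by (auto simp: inj_on_def cong_def) (metis div_mult_mod_eq)
  moreover have "(\<lambda>a. a div q) ` S \<subseteq> {0..n div q}"
    using assms(2) by (auto intro!: div_le_mono)
  ultimately have "card S \<le> n div q + 1"
    using card_inj_on_le[of _ S "{0..n div q}"] by simp
  also have "real \<dots> \<le> real n / real q + 1"
    using of_nat_div_le_of_nat[of n q] by simp
  finally show ?thesis by simp
qed

subsection \<open>The Euler product\<close>

text \<open>Unique factorization: the exponent of \<open>p\<close> is recovered as a multiplicity
  and the cofactor is prime to \<open>p\<close>. This reindexes the sum when one Euler factor is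
  added.\<close>

lemma smooth_numbers_insert:
  fixes p :: nat
  assumes p: "prime p" "p \<notin> P" and P: "\<forall>p\<in>P. prime p"
  shows "bij_betw (\<lambda>(k, m). p ^ k * m) (UNIV \<times> {m. m > 0 \<and> prime_factors m \<subseteq> P})
           {m. m > 0 \<and> prime_factors m \<subseteq> insert p P}"
proof -
  let ?S = "{m::nat. m > 0 \<and> prime_factors m \<subseteq> P}"
  have nd: "\<not> p dvd m" if "m \<in> ?S" for m
    using that p by (auto simp: prime_factors_dvd)
  show ?thesis
    unfolding bij_betw_def
  proof
    show "inj_on (\<lambda>(k, m). p ^ k * m) (UNIV \<times> ?S)"
    proof (intro inj_onI, clarsimp)
      fix k m k' m'
      assume h: "p ^ k * m = p ^ k' * m'" "0 < m" "0 < m'"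
        "prime_factors m \<subseteq> P" "prime_factors m' \<subseteq> P"
      have mult: "multiplicity p (p ^ i * j) = i" if "\<not> p dvd j" for i j :: nat
      proof (rule multiplicity_eqI)
        show "p ^ i dvd p ^ i * j" by simp
        show "\<not> p ^ Suc i dvd p ^ i * j"
          using that prime_gt_0_nat[OF p(1)] by (simp add: mult.commute[of p])
      qed
      have "k = k'"
        using mult[of m k] mult[of m' k'] h nd[of m] nd[of m'] by simp
      then show "k = k' \<and> m = m'" using h p by (auto simp: prime_gt_0_nat)
    qed
    show "(\<lambda>(k, m). p ^ k * m) ` (UNIV \<times> ?S) = {m. m > 0 \<and> prime_factors m \<subseteq> insert p P}"
    proof (intro equalityI subsetI)
      fix x assume "x \<in> (\<lambda>(k, m). p ^ k * m) ` (UNIV \<times> ?S)"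
      then obtain k m where x: "x = p ^ k * m" "m > 0" "prime_factors m \<subseteq> P" by auto
      have "r \<in> insert p P" if "r \<in> prime_factors x" for r
      proof -
        have "prime r" "r dvd p ^ k * m" using that x by auto
        then have "r dvd p \<or> r dvd m" using prime_dvd_mult_iff prime_dvd_power by blast
        then show ?thesis using \<open>prime r\<close> p x
          by (auto simp: primes_dvd_imp_eq prime_factors_dvd)
      qed
      then show "x \<in> {m. m > 0 \<and> prime_factors m \<subseteq> insert p P}"
        using x p by (auto simp: prime_gt_0_nat)
    next
      fix x assume x: "x \<in> {m. m > 0 \<and> prime_factors m \<subseteq> insert p P}"
      obtain y where y: "x = p ^ multiplicity p x * y" "\<not> p dvd y"
        using multiplicity_decompose'[of x p] x p(1) not_prime_unit[of p] by blast
      have "y dvd x" "y > 0" using y x by (metis dvd_triv_right, auto intro: Nat.gr0I)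
      then have "prime_factors y \<subseteq> insert p P" "p \<notin> prime_factors y"
        using y x dvd_prime_factors[of x y] by auto
      then have "prime_factors y \<subseteq> P" by blast
      then show "x \<in> (\<lambda>(k, m). p ^ k * m) ` (UNIV \<times> ?S)"
        using y \<open>y > 0\<close> by (intro image_eqI[of _ _ "(multiplicity p x, y)"]) auto
    qed
  qed
qed

text \<open>The finite Euler product for \<zeta>(2): each new prime multiplies the sum by a
  geometric series in \<open>1 / p\<^sup>2\<close>.\<close>

lemma has_sum_inverse_squares_smooth:
  fixes P :: "nat set"
  assumes "finite P" "\<forall>p\<in>P. prime p"
  shows "((\<lambda>m. 1 / (real m)\<^sup>2) has_sum (\<Prod>p\<in>P. 1 / (1 - 1 / (real p)\<^sup>2)))
           {m. m > 0 \<and> prime_factors m \<subseteq> P}"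
  using assms
proof (induction P rule: finite_induct)
  case empty
  have "{m::nat. m > 0 \<and> prime_factors m \<subseteq> {}} = {1}"
    by (auto simp: prime_factorization_empty_iff)
  then show ?case by (simp add: has_sum_finite_iff)
next
  case (insert p P)
  let ?S = "{m::nat. m > 0 \<and> prime_factors m \<subseteq> P}"
  let ?F = "\<Prod>p\<in>P. 1 / (1 - 1 / (real p)\<^sup>2)"
  have p: "prime p" using insert.prems by simp
  then have "real p ^ 2 > 1" using prime_gt_1_nat[of p] one_less_power[of "real p" 2] by simp
  then have "(\<lambda>k. (1 / (real p)\<^sup>2) ^ k) sums (1 / (1 - 1 / (real p)\<^sup>2))"
    by (intro geometric_sums) (simp add: divide_less_eq)
  then have geo: "((\<lambda>k. (1 / (real p)\<^sup>2) ^ k) has_sum (1 / (1 - 1 / (real p)\<^sup>2))) UNIV"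
    by (intro sums_nonneg_imp_has_sum) auto
  have eq: "1 / (real (p ^ k * m))\<^sup>2 = (1 / (real p)\<^sup>2) ^ k * (1 / (real m)\<^sup>2)" for k m
    by (simp add: power_mult_distrib power_divide power_mult[symmetric] mult.commute)
  have IH: "((\<lambda>m. 1 / (real m)\<^sup>2) has_sum ?F) ?S" using insert by auto
  have inner: "((\<lambda>m. 1 / (real (p ^ k * m))\<^sup>2) has_sum ((1 / (real p)\<^sup>2) ^ k * ?F)) ?S" for k
    unfolding eq by (intro has_sum_cmult_right IH)
  have outer: "((\<lambda>k. (1 / (real p)\<^sup>2) ^ k * ?F) has_sum (1 / (1 - 1 / (real p)\<^sup>2) * ?F)) UNIV"
    by (intro has_sum_cmult_left geo)
  have summ: "(\<lambda>(k, m). 1 / (real (p ^ k * m))\<^sup>2) summable_on (UNIV \<times> ?S)"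
    by (rule summable_on_SigmaI[where g = "\<lambda>k. (1 / (real p)\<^sup>2) ^ k * ?F"])
       (use inner outer in \<open>auto simp: summable_on_def\<close>)
  have "((\<lambda>(k, m). 1 / (real (p ^ k * m))\<^sup>2) has_sum (1 / (1 - 1 / (real p)\<^sup>2) * ?F)) (UNIV \<times> ?S)"
    by (rule has_sum_SigmaI[where g = "\<lambda>k. (1 / (real p)\<^sup>2) ^ k * ?F"])
       (use inner outer summ in auto)
  then have "((\<lambda>m. 1 / (real m)\<^sup>2) has_sum (1 / (1 - 1 / (real p)\<^sup>2) * ?F))
       {m. m > 0 \<and> prime_factors m \<subseteq> insert p P}"
    using has_sum_reindex_bij_betw[OF smooth_numbers_insert[OF p insert.hyps(2)],
        of "\<lambda>m. 1 / (real m)\<^sup>2"] insert.prems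
    by (simp add: case_prod_unfold)
  then show ?case using insert.hyps by simp
qed

definition primes_upto :: "nat \<Rightarrow> nat set" where
  "primes_upto y = {p. prime p \<and> p \<le> y}"

lemma finite_primes_upto [simp]: "finite (primes_upto y)"
  unfolding primes_upto_def by simp

lemma prime_primes_upto: "p \<in> primes_upto y \<Longrightarrow> prime p"
  unfolding primes_upto_def by simp

text \<open>A partial product of 1 / \<zeta>(2), and the density of the integers divisible by no
  \<open>p\<^sup>2\<close> with \<open>p \<le> y\<close> prime.\<close>

definition euler_prod :: "nat \<Rightarrow> real" where
  "euler_prod y = (\<Prod>p\<in>primes_upto y. 1 - 1 / (real p)\<^sup>2)"

lemma one_minus_inverse_square_pos: "prime (p::nat) \<Longrightarrow> 1 - 1 / (real p)\<^sup>2 > 0"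
  using prime_gt_1_nat[of p] one_less_power[of "real p" 2] by (simp add: field_simps)

lemma euler_prod_pos: "euler_prod y > 0"
  unfolding euler_prod_def
  by (intro prod_pos one_minus_inverse_square_pos ballI prime_primes_upto)

lemma inverse_euler_prod: "1 / euler_prod y = (\<Prod>p\<in>primes_upto y. 1 / (1 - 1 / (real p)\<^sup>2))"
  unfolding euler_prod_def by (simp add: prod_dividef)

lemma has_sum_inverse_squares: "((\<lambda>m::nat. 1 / (real m)\<^sup>2) has_sum (pi\<^sup>2 / 6)) {m. m > 0}"
proof -
  have "((\<lambda>n. 1 / (real (Suc n))\<^sup>2) has_sum (pi\<^sup>2 / 6)) UNIV"
    using inverse_squares_sums by (intro sums_nonneg_imp_has_sum) (auto simp: add.commute)
  moreover have "bij_betw Suc UNIV {m. m > 0}"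
    by (intro bij_betwI[of _ _ _ "\<lambda>m. m - 1"]) auto
  ultimately show ?thesis
    using has_sum_reindex_bij_betw[of Suc UNIV "{m. m > 0}" "\<lambda>m. 1 / (real m)\<^sup>2"] by simp
qed

text \<open>The inverse sums \<open>1 / m\<^sup>2\<close> over those \<open>m\<close> whose prime
  factors are at most \<open>y\<close>, hence is at most the sum over all positive integers.\<close>

lemma euler_prod_ge: "euler_prod y \<ge> 6 / pi\<^sup>2"
proof -
  have "1 / euler_prod y \<le> pi\<^sup>2 / 6"
    unfolding inverse_euler_prod
    by (rule has_sum_mono2[OF has_sum_inverse_squares_smooth has_sum_inverse_squares])
       (auto dest: prime_primes_upto)
  then show ?thesis using euler_prod_pos[of y] by (simp add: field_simps)
qed

text \<open>Every positive \<open>m \<le> y\<close> has all its prime factors up to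
  \<open>y\<close>, so \<open>1 / euler_prod y\<close> is squeezed between a partial sum of the
  series for \<zeta>(2) and its total.\<close>

lemma tendsto_euler_prod: "euler_prod \<longlonglongrightarrow> 6 / pi\<^sup>2"
proof -
  have lower: "(\<Sum>n<y. 1 / (real n + 1)\<^sup>2) \<le> 1 / euler_prod y" for y
  proof -
    have "(\<Sum>n<y. 1 / (real n + 1)\<^sup>2) = (\<Sum>m\<in>{1..y}. 1 / (real m)\<^sup>2)"
      by (rule sum.reindex_bij_witness[of _ "\<lambda>m. m - 1" Suc]) (auto simp: add.commute)
    also have "\<dots> \<le> 1 / euler_prod y"
      unfolding inverse_euler_prod
    proof (rule finite_sum_le_has_sum[OF has_sum_inverse_squares_smooth])
      show "{1..y} \<subseteq> {m. 0 < m \<and> prime_factors m \<subseteq> primes_upto y}"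
        by (auto simp: primes_upto_def prime_factors_dvd dest!: dvd_imp_le)
    qed (auto dest: prime_primes_upto)
    finally show ?thesis .
  qed
  have upper: "1 / euler_prod y \<le> pi\<^sup>2 / 6" for y
    using euler_prod_ge[of y] euler_prod_pos[of y] by (simp add: field_simps)
  have "(\<lambda>y. \<Sum>n<y. 1 / (real n + 1)\<^sup>2) \<longlonglongrightarrow> pi\<^sup>2 / 6"
    using inverse_squares_sums by (simp add: sums_def add.commute)
  then have "(\<lambda>y. 1 / euler_prod y) \<longlonglongrightarrow> pi\<^sup>2 / 6"
    by (rule tendsto_sandwich[rotated 2, OF _ tendsto_const]) (use lower upper in auto)
  from tendsto_divide[OF tendsto_const[of 1] this]
  have "(\<lambda>y. 1 / (1 / euler_prod y)) \<longlonglongrightarrow> 1 / (pi\<^sup>2 / 6)" by simp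
  then show ?thesis by simp
qed

subsection \<open>Squarefree numbers and densities\<close>

lemma not_squarefree_prime_square:
  assumes "\<not> squarefree (a::nat)" "a > 0"
  obtains p where "prime p" "p\<^sup>2 dvd a"
  using assms squarefree_factorial_semiring[of a] by blast

lemma squarefree_not_prime_square_dvd: "squarefree (a::nat) \<Longrightarrow> prime p \<Longrightarrow> \<not> p\<^sup>2 dvd a"
  using squarefreeD[of a p] not_prime_unit[of p] by blast

text \<open>The class of \<open>0\<close> starts at \<open>q\<close> itself, so the extra
  \<open>1\<close> of \<open>card_congruent_le\<close> disappears. This permits summing the bound
  over moduli whose number grows with \<open>N\<close>.\<close>

lemma card_multiples_le:
  assumes "q > 0"
  shows "real (card {a \<in> {1..N}. q dvd a}) \<le> real N / real q"
proof -
  have "inj_on (\<lambda>a. a div q) {a \<in> {1..N}. q dvd a}"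
    using assms by (auto simp: inj_on_def)
  moreover have "(\<lambda>a. a div q) ` {a \<in> {1..N}. q dvd a} \<subseteq> {1..N div q}"
    using assms by (auto intro!: div_le_mono simp: Suc_le_eq div_greater_zero_iff dest: dvd_imp_le)
  ultimately have "card {a \<in> {1..N}. q dvd a} \<le> N div q"
    using card_inj_on_le[of _ "{a \<in> {1..N}. q dvd a}" "{1..N div q}"] by simp
  also have "real \<dots> \<le> real N / real q" by (rule of_nat_div_le_of_nat)
  finally show ?thesis by simp
qed

text \<open>The Cauchy criterion for intervals extends to all finite sets beyond \<open>y\<close>,
  since the terms are nonnegative and such a set lies in an interval.\<close>

lemma small_tail_sum:
  fixes f :: "nat \<Rightarrow> real"
  assumes "summable f" "\<And>n. f n \<ge> 0" "\<delta> > 0"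
  obtains y where "\<And>F. finite F \<Longrightarrow> F \<subseteq> {y<..} \<Longrightarrow> sum f F < \<delta>"
proof -
  obtain y where y: "\<And>m n. m \<ge> y \<Longrightarrow> norm (sum f {m..<n}) < \<delta>"
    using assms(1,3) unfolding summable_Cauchy by blast
  have "sum f F < \<delta>" if F: "finite F" "F \<subseteq> {y<..}" for F
  proof -
    have "F \<subseteq> {y..<Suc (Max F)}" using F by (auto simp: less_Suc_eq_le less_imp_le)
    then have "sum f F \<le> sum f {y..<Suc (Max F)}"
      using assms(2) by (intro sum_mono2) auto
    also have "\<dots> < \<delta>" using y[of y "Suc (Max F)"] by auto
    finally show ?thesis .
  qed
  then show ?thesis using that by blast
qed

lemma summable_inverse_square: "summable (\<lambda>n. 1 / (real n)\<^sup>2)"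
  using inverse_power_summable[of 2, where ?'a = real] by (simp add: field_simps)

text \<open>The sieve by primes up to \<open>y\<close> supplies the main term. What it keeps wrongly
  is divisible by some \<open>p\<^sup>2\<close> with \<open>p > y\<close>, which costs at most
  \<open>N\<close> times a tail of the series of inverse squares.\<close>

lemma card_squarefree_ge:
  assumes "\<delta> > 0"
  obtains K where
    "\<And>N. real (card {a \<in> {1..N}. squarefree a}) \<ge> (6 / pi\<^sup>2 - \<delta>) * real N - K"
proof -
  obtain y where y: "\<And>F. finite F \<Longrightarrow> F \<subseteq> {y<..} \<Longrightarrow> (\<Sum>d\<in>F. 1 / (real d)\<^sup>2) < \<delta>"
    using small_tail_sum[OF summable_inverse_square _ assms] by auto
  define P where "P = primes_upto y"
  define C where "C p = {1..<p\<^sup>2}" for p :: nat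
  define K where "K = real (\<Prod>p\<in>P. p\<^sup>2) + 1"
  have prP: "prime p" if "p \<in> P" for p using that unfolding P_def by (rule prime_primes_upto)
  have D: "(\<Prod>p\<in>P. real (card (C p)) / real (p\<^sup>2)) = euler_prod y"
    unfolding euler_prod_def P_def[symmetric]
    by (intro prod.cong refl)
       (auto simp: C_def prime_gt_0_nat[OF prP] Suc_leI of_nat_diff diff_divide_distrib)
  have "real (card {a \<in> {1..N}. squarefree a}) \<ge> (6 / pi\<^sup>2 - \<delta>) * real N - K" for N
  proof -
    let ?G = "{a. a < N \<and> (\<forall>p\<in>P. a mod p\<^sup>2 \<in> C p)}"
    let ?m = "\<lambda>p::nat. {a \<in> {1..N}. p\<^sup>2 dvd a}"
    have "\<bar>real (card ?G) - real N * euler_prod y\<bar> \<le> real (\<Prod>p\<in>P. p\<^sup>2)"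
      unfolding D[symmetric]
      by (intro card_sieve)
         (auto simp: P_def C_def dest!: prime_primes_upto simp: primes_coprime intro: prime_gt_0_nat)
    moreover have "real N * (6 / pi\<^sup>2) \<le> real N * euler_prod y"
      by (intro mult_left_mono euler_prod_ge) auto
    ultimately have G: "real (card ?G) \<ge> real N * (6 / pi\<^sup>2) - (K - 1)"
      unfolding K_def by linarith
    \<comment> \<open>The number \<open>0\<close> survives the sieve only if \<open>P\<close> is
      empty; the summand \<open>1\<close> in \<open>K\<close> pays for it. Composite
      \<open>p\<close> may stay in the union because the inverse squares are summable over all
      integers.\<close>
    have "?G \<subseteq> {a \<in> {1..N}. squarefree a} \<union> {0} \<union> (\<Union>p\<in>{y<..N}. ?m p)"
    proof
      fix a assume a: "a \<in> ?G"
      show "a \<in> {a \<in> {1..N}. squarefree a} \<union> {0} \<union> (\<Union>p\<in>{y<..N}. ?m p)"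
      proof (cases "a = 0 \<or> squarefree a")
        case False
        then obtain p where p: "prime p" "p\<^sup>2 dvd a" using not_squarefree_prime_square[of a] by auto
        have "p \<notin> P" using p(2) a by (auto simp: C_def)
        then have "p > y" using p by (auto simp: P_def primes_upto_def)
        moreover have "p \<le> p\<^sup>2" by (rule power2_nat_le_imp_le) simp
        moreover have "p\<^sup>2 \<le> a" using p(2) False by (intro dvd_imp_le) auto
        ultimately show ?thesis using a p False by (intro UnI2) auto
      qed (use a in auto)
    qed
    then have "card ?G \<le> card ({a \<in> {1..N}. squarefree a} \<union> {0} \<union> (\<Union>p\<in>{y<..N}. ?m p))"
      by (intro card_mono) auto
    also have "\<dots> \<le> card {a \<in> {1..N}. squarefree a} + 1 + card (\<Union>p\<in>{y<..N}. ?m p)"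
      by (intro order.trans[OF card_Un_le] add_mono) auto
    also have "card (\<Union>p\<in>{y<..N}. ?m p) \<le> (\<Sum>p\<in>{y<..N}. card (?m p))"
      by (intro card_UN_le) auto
    finally have "real (card ?G) \<le> real (card {a \<in> {1..N}. squarefree a}) + 1
        + (\<Sum>p\<in>{y<..N}. real (card (?m p)))"
      by (simp flip: of_nat_sum)
    moreover have "(\<Sum>p\<in>{y<..N}. real (card (?m p))) \<le> (\<Sum>p\<in>{y<..N}. real N * (1 / (real p)\<^sup>2))"
      using card_multiples_le[of "_\<^sup>2" N] by (intro sum_mono) auto
    moreover have "(\<Sum>p\<in>{y<..N}. real N * (1 / (real p)\<^sup>2)) \<le> real N * \<delta>"
      unfolding sum_distrib_left[symmetric]
      by (intro mult_left_mono less_imp_le[OF y]) auto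
    ultimately show ?thesis using G by (simp add: algebra_simps)
  qed
  then show ?thesis using that by blast
qed

section \<open>Two shifts: the saving at one prime\<close>

lemma residue_dvd_add_singleton:
  fixes Q n :: nat
  assumes "Q > 0"
  shows "\<exists>r. {r. r < Q \<and> Q dvd n + r} = {r}"
proof -
  have "\<exists>r<Q. Q dvd n + r"
  proof (intro exI conjI)
    show "(Q - n mod Q) mod Q < Q" using assms by simp
    have "(n + (Q - n mod Q) mod Q) mod Q = (n mod Q + (Q - n mod Q)) mod Q"
      by (simp add: mod_simps)
    also have "\<dots> = 0" using assms by (simp add: less_imp_le)
    finally show "Q dvd n + (Q - n mod Q) mod Q" by auto
  qed
  moreover have "r = s" if "r < Q" "s < Q" "Q dvd n + r" "Q dvd n + s" for r s
  proof -
    have "[n + r = n + s] (mod Q)" using that(3,4) by (simp add: cong_def)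
    then have "[r = s] (mod Q)" by (simp add: cong_add_lcancel_nat)
    then show ?thesis using that by (simp add: cong_def)
  qed
  ultimately show ?thesis by blast
qed

text \<open>Sieving for one shift gives constants approaching 6 / \<pi>^2 from above; a second
  excluded class at one prime brings \<open>c\<close> strictly below it.\<close>

lemma card_two_shifts_squarefree_le:
  fixes m n :: nat
  assumes "m < n"
  obtains c K where "c < 6 / pi\<^sup>2"
    "\<And>N. real (card {a \<in> {1..N}. squarefree (m + a) \<and> squarefree (n + a)}) \<le> c * real N + K"
proof -
  obtain q where q: "prime q" "q > n" using bigger_prime by blast
  \<comment> \<open>Modulo \<open>q\<^sup>2 > n - m\<close> the two shifts exclude two distinct classes instead of one; \<open>\<kappa>\<close> is the
    resulting saving over the Euler product.\<close>
  define \<kappa> where "\<kappa> = (1 - 2 / (real q)\<^sup>2) / (1 - 1 / (real q)\<^sup>2)"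
  have q2: "(real q)\<^sup>2 \<ge> 2\<^sup>2" using prime_ge_2_nat[OF q(1)] by (intro power_mono) auto
  have inv_q: "1 / (real q)\<^sup>2 > 0" "1 / (real q)\<^sup>2 < 1"
    using q2 prime_gt_0_nat[OF q(1)] by (simp_all add: divide_less_eq)
  moreover have "2 / (real q)\<^sup>2 = 2 * (1 / (real q)\<^sup>2)" by simp
  ultimately have \<kappa>: "\<kappa> < 1"
    unfolding \<kappa>_def by (subst divide_less_eq_1_pos) linarith+
  \<comment> \<open>The midpoint of the limit \<open>6 / pi\<^sup>2 * \<kappa>\<close> and
    \<open>6 / pi\<^sup>2\<close>, which leaves room for stopping the Euler product at a finite
    \<open>y\<close>.\<close>
  define c where "c = 6 / pi\<^sup>2 * ((1 + \<kappa>) / 2)"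
  have "(\<lambda>y. euler_prod y * \<kappa>) \<longlonglongrightarrow> 6 / pi\<^sup>2 * \<kappa>"
    by (intro tendsto_mult tendsto_euler_prod tendsto_const)
  moreover have "6 / pi\<^sup>2 * \<kappa> < c" unfolding c_def using \<kappa> by (intro mult_strict_left_mono) auto
  ultimately have "eventually (\<lambda>y. euler_prod y * \<kappa> < c) sequentially"
    by (rule order_tendstoD)
  then have "eventually (\<lambda>y. euler_prod y * \<kappa> < c \<and> y \<ge> q) sequentially"
    by (intro eventually_conj eventually_ge_at_top)
  then obtain y where y: "euler_prod y * \<kappa> < c" "y \<ge> q"
    using eventually_happens'[OF sequentially_bot] by blast
  define P where "P = primes_upto y"
  have qP: "q \<in> P" using q y by (simp add: P_def primes_upto_def)
  define R where "R k p = {r. r < p\<^sup>2 \<and> p\<^sup>2 dvd k + r}" for k p :: nat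
  \<comment> \<open>The class of \<open>-m\<close> is removed at every prime, that of
    \<open>-n\<close> only at \<open>q\<close>.\<close>
  define C where "C p = {..<p\<^sup>2} - (if p = q then R m p \<union> R n p else R m p)" for p
  have prP: "prime p" if "p \<in> P" for p using that unfolding P_def by (rule prime_primes_upto)
  have R: "card (R k p) = 1" "R k p \<subseteq> {..<p\<^sup>2}" "finite (R k p)" if "p > 0" for k p
  proof -
    obtain r where "R k p = {r}" using residue_dvd_add_singleton[of "p\<^sup>2" k] \<open>p > 0\<close> unfolding R_def by auto
    then show "card (R k p) = 1" "finite (R k p)" by simp_all
    show "R k p \<subseteq> {..<p\<^sup>2}" unfolding R_def by auto
  qed
  have disj: "R m q \<inter> R n q = {}"
  proof -
    have False if "q\<^sup>2 dvd m + r" "q\<^sup>2 dvd n + r" for r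
    proof -
      have "q\<^sup>2 dvd (n + r) - (m + r)" using that by (intro dvd_diff_nat)
      then have "q\<^sup>2 \<le> n - m" using assms by (intro dvd_imp_le) auto
      moreover have "q \<le> q\<^sup>2" by (rule power2_nat_le_imp_le) simp
      ultimately show False using q(2) by linarith
    qed
    then show ?thesis by (auto simp: R_def)
  qed
  have cardC: "real (card (C p)) / real (p\<^sup>2)
      = (1 - 1 / (real p)\<^sup>2) * (if p = q then \<kappa> else 1)" if p: "p \<in> P" for p
  proof -
    have p0: "p > 0" using prP[OF p] by (rule prime_gt_0_nat)
    show ?thesis
    proof (cases "p = q")
      case True
      have "card (R m p \<union> R n p) = 2" using R[OF p0] disj True by (simp add: card_Un_disjoint)
      then have "card (C p) = p\<^sup>2 - 2" using True R[OF p0]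
        unfolding C_def by (subst card_Diff_subset) auto
      moreover have "2 \<le> p\<^sup>2" using q2 True by (simp flip: of_nat_power)
      ultimately have "real (card (C p)) = (real p)\<^sup>2 - 2" by (simp add: of_nat_diff)
      then have "real (card (C p)) / real (p\<^sup>2) = 1 - 2 / (real q)\<^sup>2"
        using True p0 by (simp add: diff_divide_distrib)
      moreover have "(1 - 1 / (real q)\<^sup>2) * \<kappa> = 1 - 2 / (real q)\<^sup>2"
        unfolding \<kappa>_def using inv_q by (metis less_irrefl diff_gt_0_iff_gt nonzero_mult_div_cancel_left times_divide_eq_right)
      ultimately show ?thesis using True by simp
    next
      case False
      then have "card (C p) = p\<^sup>2 - 1"
        using R[OF p0] unfolding C_def by (simp add: card_Diff_subset)
      then have "real (card (C p)) = (real p)\<^sup>2 - 1" using p0 by (simp add: of_nat_diff Suc_leI)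
      then show ?thesis using False p0 by (simp add: diff_divide_distrib)
    qed
  qed
  have D: "(\<Prod>p\<in>P. real (card (C p)) / real (p\<^sup>2)) = euler_prod y * \<kappa>"
  proof -
    have "(\<Prod>p\<in>P. real (card (C p)) / real (p\<^sup>2))
        = (\<Prod>p\<in>P. (1 - 1 / (real p)\<^sup>2) * (if p = q then \<kappa> else 1))"
      by (rule prod.cong[OF refl cardC])
    then show ?thesis
      using qP unfolding euler_prod_def P_def by (simp add: prod.distrib prod.delta)
  qed
  \<comment> \<open>The sieve counts from \<open>0\<close> to \<open>N\<close>, that is
    \<open>Suc N\<close> integers; \<open>\<bar>c\<bar>\<close> absorbs the additional one.\<close>
  define K where "K = real (\<Prod>p\<in>P. p\<^sup>2) + \<bar>c\<bar>"
  have "real (card {a \<in> {1..N}. squarefree (m + a) \<and> squarefree (n + a)}) \<le> c * real N + K" for N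
  proof -
    let ?G = "{a. a < Suc N \<and> (\<forall>p\<in>P. a mod p\<^sup>2 \<in> C p)}"
    have "\<bar>real (card ?G) - real (Suc N) * (euler_prod y * \<kappa>)\<bar> \<le> real (\<Prod>p\<in>P. p\<^sup>2)"
      unfolding D[symmetric]
      by (intro card_sieve)
         (auto simp: P_def C_def dest!: prime_primes_upto simp: primes_coprime intro: prime_gt_0_nat)
    moreover have "real (Suc N) * (euler_prod y * \<kappa>) \<le> real (Suc N) * c"
      using y by (intro mult_left_mono) auto
    ultimately have "real (card ?G) \<le> c * real N + K"
      unfolding K_def by (simp add: algebra_simps)
    moreover have "{a \<in> {1..N}. squarefree (m + a) \<and> squarefree (n + a)} \<subseteq> ?G"
    proof
      fix a assume a: "a \<in> {a \<in> {1..N}. squarefree (m + a) \<and> squarefree (n + a)}"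
      have "a mod p\<^sup>2 \<in> C p" if p: "p \<in> P" for p
      proof -
        have "(k + a mod p\<^sup>2) mod p\<^sup>2 = (k + a) mod p\<^sup>2" for k by (simp add: mod_simps)
        then have "p\<^sup>2 dvd k + a mod p\<^sup>2 \<longleftrightarrow> p\<^sup>2 dvd k + a" for k by (simp add: dvd_eq_mod_eq_0)
        then show ?thesis
          using a prP[OF p] by (auto simp: C_def R_def squarefree_not_prime_square_dvd prime_gt_0_nat)
      qed
      then show "a \<in> ?G" using a by auto
    qed
    then have "card {a \<in> {1..N}. squarefree (m + a) \<and> squarefree (n + a)} \<le> card ?G"
      by (intro card_mono) auto
    ultimately show ?thesis by linarith
  qed
  moreover have "c < 6 / pi\<^sup>2" unfolding c_def using \<kappa> by (simp add: field_simps)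
  ultimately show ?thesis using that by blast
qed

section \<open>From counts up to integers to densities\<close>

lemma initial_segment_eq: "x \<ge> 0 \<Longrightarrow> initial_segment x = {1..nat \<lfloor>x\<rfloor>}"
  by (auto simp: initial_segment_def Npos_def le_nat_floor Suc_le_eq le_nat_iff le_floor_iff)

text \<open>Replacing \<open>x\<close> by its floor costs at most \<open>\<bar>c\<bar>\<close>, and
  the gap \<open>(c' - c) * x\<close> eventually exceeds \<open>\<bar>c\<bar> + K\<close>.\<close>

lemma upper_density_le:
  assumes "\<And>N. real (card (A \<inter> {1..N})) \<le> c * real N + K" "c < c'"
  shows "upper_density A \<le> ereal c'"
  unfolding upper_density_def
proof (rule Limsup_bounded, rule eventually_mono[OF eventually_ge_at_top])
  fix x :: real assume x: "x \<ge> max 1 ((\<bar>c\<bar> + K) / (c' - c))"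
  let ?N = "nat \<lfloor>x\<rfloor>"
  have N: "real ?N \<le> x" "real ?N > x - 1" using x of_nat_nat[of "\<lfloor>x\<rfloor>", where ?'a = real] by linarith+
  have "c * (real ?N - x) \<le> \<bar>c\<bar> * \<bar>real ?N - x\<bar>" unfolding abs_mult[symmetric] by (rule abs_ge_self)
  also have "\<dots> \<le> \<bar>c\<bar> * 1" using N by (intro mult_left_mono abs_ge_zero) linarith
  finally have "c * (real ?N - x) \<le> \<bar>c\<bar>" by simp
  then have "c * real ?N + K \<le> c * x + (\<bar>c\<bar> + K)" by (simp add: algebra_simps)
  also have "\<bar>c\<bar> + K \<le> (c' - c) * x"
    using x assms(2) by (simp add: divide_le_eq mult.commute)
  finally have "real (card (A \<inter> {1..?N})) \<le> c' * x"
    using assms(1)[of ?N] by (simp add: algebra_simps)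
  then show "ereal (real (card (A \<inter> initial_segment x)) / x) \<le> ereal c'"
    using x by (simp add: initial_segment_eq divide_le_eq)
qed

lemma lower_density_ge:
  assumes "\<And>N. real (card (A \<inter> {1..N})) \<ge> c * real N - K" "c' < c"
  shows "lower_density A \<ge> ereal c'"
  unfolding lower_density_def
proof (rule Liminf_bounded, rule eventually_mono[OF eventually_ge_at_top])
  fix x :: real assume x: "x \<ge> max 1 ((\<bar>c\<bar> + K) / (c - c'))"
  let ?N = "nat \<lfloor>x\<rfloor>"
  have N: "real ?N \<le> x" "real ?N > x - 1" using x of_nat_nat[of "\<lfloor>x\<rfloor>", where ?'a = real] by linarith+
  have "c * (x - real ?N) \<le> \<bar>c\<bar> * \<bar>x - real ?N\<bar>" unfolding abs_mult[symmetric] by (rule abs_ge_self)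
  also have "\<dots> \<le> \<bar>c\<bar> * 1" using N by (intro mult_left_mono abs_ge_zero) linarith
  finally have "c * (x - real ?N) \<le> \<bar>c\<bar>" by simp
  then have "c * real ?N - K \<ge> c * x - (\<bar>c\<bar> + K)" by (simp add: algebra_simps)
  moreover have "\<bar>c\<bar> + K \<le> (c - c') * x"
    using x assms(2) by (simp add: divide_le_eq mult.commute)
  ultimately have "real (card (A \<inter> {1..?N})) \<ge> c' * x"
    using assms(1)[of ?N] by (simp add: algebra_simps)
  then show "ereal c' \<le> ereal (real (card (A \<inter> initial_segment x)) / x)"
    using x by (simp add: initial_segment_eq le_divide_eq)
qed

subsection \<open>Shifts preserving squarefreeness\<close>

text \<open>
  The shift is \<open>n = M * k\<close> with \<open>M = (fact y)\<^sup>2\<close>, so only primes \<open>p > y\<close> can spoil \<open>n + a\<close>.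
  Those with \<open>p\<^sup>2 \<le> 4 * a\<close> are controlled for every \<open>n\<close>, since a residue class modulo \<open>p\<^sup>2\<close> has
  at most \<open>x / p\<^sup>2 + 1 \<le> 5 * x / p\<^sup>2\<close> elements up to \<open>x\<close>. For the others we average over \<open>k\<close> the
  sum \<open>W\<close> of \<open>1 / a\<close> over spoiled \<open>a\<close>: a bound \<open>W k \<le> \<delta> / 2\<close> controls the counts for all \<open>x\<close>
  at once, so no union bound over scales is needed.
\<close>

lemma exists_good_shift:
  fixes \<delta> :: real and N\<^sub>0 :: nat
  assumes "\<delta> > 0"
  shows "\<exists>n>N\<^sub>0. \<forall>x. real (card {a \<in> {1..x}. squarefree a \<and> \<not> squarefree (n + a)}) \<le> \<delta> * real x"
proof -
  \<comment> \<open>Weights for splitting \<open>1 / (a * p\<^sup>2)\<close> when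
    \<open>a \<le> p\<^sup>2\<close>: the factor \<open>a powr (1/4) \<le> p powr (1/2)\<close>
    makes the sum over \<open>a\<close> converge, while the exponent of \<open>p\<close> stays below
    \<open>-1\<close>.\<close>
  define f g where "f d = real d powr (-3/2)" and "g a = real a powr (-5/4)" for d a :: nat
  define Z where "Z = suminf g"
  have sum_f: "summable f" and sum_g: "summable g"
    unfolding f_def g_def by (simp_all add: summable_real_powr_iff)
  have f0: "f d \<ge> 0" and g0: "g a \<ge> 0" for d a unfolding f_def g_def by simp_all
  have Z: "sum g F \<le> Z" if "finite F" for F
    unfolding Z_def using that sum_g g0 by (intro sum_le_suminf) auto
  have "Z \<ge> 1" using Z[of "{1}"] by (simp add: g_def)
  \<comment> \<open>The first bound keeps the primes with \<open>p\<^sup>2 \<le> 4 * x\<close>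
    within half of \<open>\<delta> * x\<close>; the second keeps the main part of the mean of
    \<open>W\<close> within \<open>\<delta> / 4\<close>.\<close>
  define \<eta> where "\<eta> = min (\<delta> / 10) (\<delta> / (4 * Z))"
  have "\<eta> > 0" using assms \<open>Z \<ge> 1\<close> unfolding \<eta>_def by simp
  have \<eta>: "5 * \<eta> \<le> \<delta> / 2" "\<eta> * Z \<le> \<delta> / 4"
  proof -
    show "5 * \<eta> \<le> \<delta> / 2" unfolding \<eta>_def by linarith
    have "\<eta> * Z \<le> \<delta> / (4 * Z) * Z" using \<open>Z \<ge> 1\<close> unfolding \<eta>_def by (intro mult_right_mono) auto
    then show "\<eta> * Z \<le> \<delta> / 4" using \<open>Z \<ge> 1\<close> by simp
  qed
  obtain y0 where y0: "\<And>F. finite F \<Longrightarrow> F \<subseteq> {y0<..} \<Longrightarrow> sum f F < \<eta>"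
    using small_tail_sum[OF sum_f f0 \<open>\<eta> > 0\<close>] by blast
  \<comment> \<open>Besides making the tail of \<open>f\<close> small, \<open>y > N\<^sub>0\<close>
    forces \<open>n \<ge> M \<ge> y > N\<^sub>0\<close>.\<close>
  define y where "y = max y0 N\<^sub>0 + 1"
  have tail: "sum f F \<le> \<eta>" if "finite F" "F \<subseteq> {y<..}" for F
    using that by (intro less_imp_le y0) (auto simp: y_def)
  define M :: nat where "M = (fact y)\<^sup>2"
  have "y \<le> fact y" by (rule fact_ge_self)
  also have "\<dots> \<le> M" unfolding M_def by (rule power2_nat_le_imp_le) simp
  finally have "y \<le> M" .
  then have "M > N\<^sub>0" "M > 0" unfolding y_def by auto
  have cop: "coprime M (p\<^sup>2)" if "prime p" "p > y" for p
  proof -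
    have "\<not> p dvd fact y" using that by (simp add: prime_dvd_fact_iff)
    then have "coprime p (fact y)" using that(1) by (simp add: prime_imp_coprime)
    then show ?thesis unfolding M_def by (simp add: coprime_commute)
  qed
  \<comment> \<open>The expression has order \<open>K powr (-1/4)\<close>. It bounds what the
    summand \<open>1\<close> in \<open>count_k\<close> contributes to the mean of \<open>W\<close>
    over \<open>k\<close>.\<close>
  have "((\<lambda>K. Z * (m * K) powr (1/4) * sqrt (2 * m * K) / K) \<longlongrightarrow> 0) at_top" if "m > 0" for m
    using that by real_asymp
  from filterlim_compose[OF this filterlim_real_sequentially, of "real M"]
  have "eventually (\<lambda>K. Z * (real M * real K) powr (1/4) * sqrt (2 * real M * real K) / real K < \<delta> / 4)
          sequentially"
    using assms \<open>M > 0\<close> by (intro order_tendstoD(2)) auto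
  then have "eventually (\<lambda>K. Z * (real M * real K) powr (1/4) * sqrt (2 * real M * real K) / real K < \<delta> / 4
      \<and> K > 0) sequentially"
    by (intro eventually_conj eventually_gt_at_top)
  then obtain K where K: "Z * (real M * real K) powr (1/4) * sqrt (2 * real M * real K) / real K < \<delta> / 4"
      "K > 0"
    using eventually_happens'[OF sequentially_bot] by blast
  define L where "L = M * K"
  define bad where "bad n a \<longleftrightarrow> (\<exists>p. prime p \<and> y < p \<and> 4 * a < p\<^sup>2 \<and> p\<^sup>2 dvd n + a)" for n a
  \<comment> \<open>For \<open>k \<le> K\<close> and \<open>a \<le> L\<close> one has
    \<open>M * k + a \<le> 2 * L\<close>, so every prime that makes \<open>a\<close> bad lies in the
    finite set \<open>Q a\<close>.\<close>
  define Q where "Q a = {p. prime p \<and> y < p \<and> 4 * a < p\<^sup>2 \<and> p\<^sup>2 \<le> 2 * L}" for a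
  define W where "W k = (\<Sum>a\<in>{1..L}. of_bool (bad (M * k) a) / real a)" for k
  have Q_sub: "Q a \<subseteq> {1..nat \<lfloor>sqrt (2 * real L)\<rfloor>}" for a
  proof
    fix p assume p: "p \<in> Q a"
    then have "p\<^sup>2 \<le> 2 * L" "p \<ge> 1" by (auto simp: Q_def prime_ge_1_nat)
    from this(1) have "(real p)\<^sup>2 \<le> 2 * real L" by (simp flip: of_nat_power of_nat_mult add: of_nat_le_iff[symmetric])
    then have "real p \<le> sqrt (2 * real L)" by (rule real_le_rsqrt)
    then show "p \<in> {1..nat \<lfloor>sqrt (2 * real L)\<rfloor>}" using \<open>p \<ge> 1\<close> by (auto intro: le_nat_floor)
  qed
  then have finQ: "finite (Q a)" for a by (rule finite_subset) simp
  have cardQ: "real (card (Q a)) \<le> sqrt (2 * real L)" for a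
  proof -
    have "real (card (Q a)) \<le> real (nat \<lfloor>sqrt (2 * real L)\<rfloor>)"
      using card_mono[OF _ Q_sub, of a] by (subst of_nat_le_iff) simp
    also have "\<dots> \<le> sqrt (2 * real L)" by (rule of_nat_floor) simp
    finally show ?thesis .
  qed
  \<comment> \<open>Since \<open>M\<close> is invertible modulo \<open>p\<^sup>2\<close>, the
    condition fixes \<open>k\<close> modulo \<open>p\<^sup>2\<close>.\<close>
  have count_k: "real (card {k \<in> {1..K}. p\<^sup>2 dvd M * k + a}) \<le> real K / (real p)\<^sup>2 + 1"
    if p: "p \<in> Q a" for p a
  proof -
    have p': "prime p" "p > y" using p by (auto simp: Q_def)
    have "[k = l] (mod p\<^sup>2)" if "p\<^sup>2 dvd M * k + a" "p\<^sup>2 dvd M * l + a" for k l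
    proof -
      have "[M * k + a = M * l + a] (mod p\<^sup>2)" using that by (simp add: cong_def)
      then have "[M * k = M * l] (mod p\<^sup>2)" by (simp add: cong_add_rcancel_nat)
      then show ?thesis using cop[OF p'] by (simp add: cong_mult_lcancel_nat)
    qed
    then have "real (card {k \<in> {1..K}. p\<^sup>2 dvd M * k + a}) \<le> real K / real (p\<^sup>2) + 1"
      using prime_gt_0_nat[OF p'(1)] by (intro card_congruent_le) auto
    then show ?thesis by simp
  qed
  have g_powr: "g a * real a powr (1/4) = 1 / real a" if "a \<ge> 1" for a
  proof -
    have "g a * real a powr (1/4) = real a powr (-5/4 + 1/4)"
      unfolding g_def by (rule powr_add[symmetric])
    also have "-5/4 + 1/4 = (-1 :: real)" by simp
    finally show ?thesis using that by (simp add: powr_minus_divide)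
  qed
  \<comment> \<open>\<open>a \<le> p\<^sup>2\<close> lets us trade \<open>p powr (-1/2)\<close> for \<open>a powr (-1/4)\<close>, so that the double sum factors
    into a convergent series in \<open>a\<close> and a small tail in \<open>p\<close>.\<close>
  have weight: "1 / (real a * (real p)\<^sup>2) \<le> g a * f p" if "p \<in> Q a" "a \<ge> 1" for a p
  proof -
    have p: "real p > 0" using that(1) by (auto simp: Q_def prime_gt_0_nat)
    have "real a \<le> real (p\<^sup>2)" using that by (subst of_nat_le_iff) (auto simp: Q_def)
    then have "real a powr (1/4) \<le> (real p powr 2) powr (1/4)"
      using p by (intro powr_mono2) (auto simp: powr_numeral)
    then have *: "real a powr (1/4) \<le> real p powr (1/2)" by (simp only: powr_powr) simp
    have "1 / (real a * (real p)\<^sup>2) = (g a * real a powr (1/4)) * real p powr (-2)"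
      using that p by (simp add: g_powr powr_minus_divide)
    also have "\<dots> \<le> (g a * real p powr (1/2)) * real p powr (-2)"
      using * g0 by (intro mult_right_mono mult_left_mono) auto
    also have "\<dots> = g a * f p"
      using p by (simp add: f_def powr_add[symmetric])
    finally show ?thesis .
  qed
  have inv_le: "1 / real a \<le> g a * real L powr (1/4)" if "a \<in> {1..L}" for a
  proof -
    have "1 / real a = g a * real a powr (1/4)"
      using that by (simp add: g_powr)
    also have "\<dots> \<le> g a * real L powr (1/4)"
      using that g0 by (intro mult_left_mono powr_mono2) auto
    finally show ?thesis .
  qed
  \<comment> \<open>First moment over \<open>k\<close>: badness is bounded by the number of
    \<open>p \<in> Q a\<close> that cause it, and the sum over \<open>k\<close> is moved inside,
    where it counts members of a residue class.\<close>
  have "(\<Sum>k\<in>{1..K}. W k)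
      \<le> (\<Sum>k\<in>{1..K}. \<Sum>a\<in>{1..L}. \<Sum>p\<in>Q a. of_bool (p\<^sup>2 dvd M * k + a) / real a)"
    unfolding W_def
  proof (intro sum_mono)
    fix k a assume k: "k \<in> {1..K}" and a: "a \<in> {1..L}"
    have "of_bool (bad (M * k) a) \<le> (\<Sum>p\<in>Q a. of_bool (p\<^sup>2 dvd M * k + a) :: real)"
    proof (cases "bad (M * k) a")
      case True
      then obtain p where p: "prime p" "y < p" "4 * a < p\<^sup>2" "p\<^sup>2 dvd M * k + a"
        unfolding bad_def by blast
      have "p\<^sup>2 \<le> M * k + a" using p(4) a by (intro dvd_imp_le) auto
      also have "M * k \<le> L" using k by (simp add: L_def)
      also have "L + a \<le> 2 * L" using a by simp
      finally have "p \<in> Q a" using p by (simp add: Q_def)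
      then have "of_bool (p\<^sup>2 dvd M * k + a) \<le> (\<Sum>p\<in>Q a. of_bool (p\<^sup>2 dvd M * k + a) :: real)"
        using finQ by (intro member_le_sum) auto
      then show ?thesis using p(4) by simp
    qed (simp add: sum_nonneg)
    then show "of_bool (bad (M * k) a) / real a \<le> (\<Sum>p\<in>Q a. of_bool (p\<^sup>2 dvd M * k + a) / real a)"
      unfolding sum_divide_distrib[symmetric] by (intro divide_right_mono) auto
  qed
  also have "\<dots> = (\<Sum>a\<in>{1..L}. \<Sum>k\<in>{1..K}. \<Sum>p\<in>Q a. of_bool (p\<^sup>2 dvd M * k + a) / real a)"
    by (rule sum.swap)
  also have "\<dots> = (\<Sum>a\<in>{1..L}. \<Sum>p\<in>Q a. \<Sum>k\<in>{1..K}. of_bool (p\<^sup>2 dvd M * k + a) / real a)"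
    by (rule sum.cong[OF refl], rule sum.swap)
  also have "\<dots> = (\<Sum>a\<in>{1..L}. \<Sum>p\<in>Q a. real (card {k \<in> {1..K}. p\<^sup>2 dvd M * k + a}) / real a)"
    by (simp add: sum_divide_distrib[symmetric] of_bool_def sum.If_cases Int_def)
  \<comment> \<open>The term with \<eta> comes from \<open>K / p\<^sup>2\<close>, the other from the
    summand \<open>1\<close> taken once for each of at most \<open>sqrt (2 * L)\<close>
    primes.\<close>
  also have "\<dots> \<le> (\<Sum>a\<in>{1..L}. g a * (K * \<eta> + sqrt (2 * real L) * real L powr (1/4)))"
  proof (intro sum_mono)
    fix a assume a: "a \<in> {1..L}"
    have tail_Q: "(\<Sum>p\<in>Q a. g a * f p) \<le> g a * \<eta>"
      unfolding sum_distrib_left[symmetric]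
      by (intro mult_left_mono tail finQ g0) (auto simp: Q_def)
    have "(\<Sum>p\<in>Q a. real (card {k \<in> {1..K}. p\<^sup>2 dvd M * k + a}) / real a)
        \<le> (\<Sum>p\<in>Q a. (real K / (real p)\<^sup>2 + 1) / real a)"
      by (intro sum_mono divide_right_mono count_k) auto
    also have "\<dots> = (\<Sum>p\<in>Q a. K * (1 / (real a * (real p)\<^sup>2)) + 1 / real a)"
      by (intro sum.cong refl) (simp add: add_divide_distrib mult.commute)
    also have "\<dots> = K * (\<Sum>p\<in>Q a. 1 / (real a * (real p)\<^sup>2)) + real (card (Q a)) * (1 / real a)"
      by (simp only: sum.distrib sum_distrib_left sum_constant)
    also have "\<dots> \<le> K * (\<Sum>p\<in>Q a. g a * f p) + sqrt (2 * real L) * (g a * real L powr (1/4))"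
      using a by (intro add_mono mult_left_mono mult_mono sum_mono weight cardQ inv_le) auto
    also have "\<dots> \<le> K * (g a * \<eta>) + sqrt (2 * real L) * (g a * real L powr (1/4))"
      using tail_Q by (intro add_right_mono mult_left_mono) auto
    finally show "(\<Sum>p\<in>Q a. real (card {k \<in> {1..K}. p\<^sup>2 dvd M * k + a}) / real a)
        \<le> g a * (K * \<eta> + sqrt (2 * real L) * real L powr (1/4))"
      by (simp add: algebra_simps)
  qed
  also have "\<dots> \<le> Z * (K * \<eta> + sqrt (2 * real L) * real L powr (1/4))"
    unfolding sum_distrib_right[symmetric] using \<open>\<eta> > 0\<close> by (intro mult_right_mono Z) auto
  also have "\<dots> < K * (\<delta> / 2)"
  proof -
    have "Z * (sqrt (2 * real L) * real L powr (1/4)) < \<delta> / 4 * K"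
      using K by (simp add: L_def field_simps)
    moreover have "K * (\<eta> * Z) \<le> K * (\<delta> / 4)" by (intro mult_left_mono \<eta>) auto
    ultimately show ?thesis by (simp add: algebra_simps)
  qed
  finally have total: "(\<Sum>k\<in>{1..K}. W k) < K * (\<delta> / 2)" .
  have "\<exists>k\<in>{1..K}. W k < \<delta> / 2"
  proof (rule ccontr)
    assume "\<not> ?thesis"
    then have "(\<Sum>k\<in>{1..K}. \<delta> / 2) \<le> (\<Sum>k\<in>{1..K}. W k)"
      by (intro sum_mono) (simp only: bex_simps not_less)
    then show False using total by simp
  qed
  then obtain k where k: "k \<in> {1..K}" "W k < \<delta> / 2" by blast
  define n where "n = M * k"
  have "M \<le> n" "n \<le> L" using k(1) by (auto simp: n_def L_def)
  have "real (card {a \<in> {1..x}. squarefree a \<and> \<not> squarefree (n + a)}) \<le> \<delta> * real x" for x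
  proof -
    define T where "T = {p. y < p \<and> p\<^sup>2 \<le> 4 * x}"
    define B where "B = {a \<in> {1..x}. bad n a}"
    let ?m = "\<lambda>p::nat. {a \<in> {1..x}. p\<^sup>2 dvd n + a}"
    have "T \<subseteq> {..4 * x}"
      by (auto simp: T_def intro: order.trans[OF power2_nat_le_imp_le[OF order.refl]])
    then have finT: "finite T" by (rule finite_subset) simp
    have "{a \<in> {1..x}. squarefree a \<and> \<not> squarefree (n + a)} \<subseteq> (\<Union>p\<in>T. ?m p) \<union> B"
    proof
      fix a assume a: "a \<in> {a \<in> {1..x}. squarefree a \<and> \<not> squarefree (n + a)}"
      then obtain p where p: "prime p" "p\<^sup>2 dvd n + a"
        using not_squarefree_prime_square[of "n + a"] by auto
      have "y < p"
      proof (rule ccontr)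
        assume "\<not> y < p"
        then have "p dvd fact y" using p(1) by (simp add: prime_dvd_fact_iff)
        then have "p\<^sup>2 dvd n" unfolding n_def M_def by (intro dvd_mult2 dvd_power_same)
        then have "p\<^sup>2 dvd a" using p(2) by (simp add: dvd_add_right_iff)
        then show False using a p(1) squarefree_not_prime_square_dvd[of a p] by blast
      qed
      then show "a \<in> (\<Union>p\<in>T. ?m p) \<union> B"
        using a p by (cases "4 * a < p\<^sup>2") (auto simp: T_def B_def bad_def)
    qed
    then have "card {a \<in> {1..x}. squarefree a \<and> \<not> squarefree (n + a)} \<le> card ((\<Union>p\<in>T. ?m p) \<union> B)"
      using finT by (intro card_mono) (auto simp: B_def)
    also have "\<dots> \<le> (\<Sum>p\<in>T. card (?m p)) + card B"
      using card_UN_le[OF finT] by (intro order.trans[OF card_Un_le] add_mono) auto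
    finally have "real (card {a \<in> {1..x}. squarefree a \<and> \<not> squarefree (n + a)})
        \<le> (\<Sum>p\<in>T. real (card (?m p))) + real (card B)"
      by (simp flip: of_nat_sum of_nat_add)
    also have "(\<Sum>p\<in>T. real (card (?m p))) \<le> (\<Sum>p\<in>T. 5 * real x * f p)"
    proof (intro sum_mono)
      fix p assume p: "p \<in> T"
      then have "p > 0" by (simp add: T_def)
      have "[a = b] (mod p\<^sup>2)" if "a \<in> ?m p" "b \<in> ?m p" for a b
      proof -
        have "[n + a = n + b] (mod p\<^sup>2)" using that by (simp add: cong_def)
        then show ?thesis by (simp add: cong_add_lcancel_nat)
      qed
      then have "real (card (?m p)) \<le> real x / real (p\<^sup>2) + 1"
        using \<open>p > 0\<close> by (intro card_congruent_le) auto
      also have "1 \<le> 4 * real x / real (p\<^sup>2)"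
      proof -
        have "real (p\<^sup>2) \<le> real (4 * x)" using p by (subst of_nat_le_iff) (simp add: T_def)
        then show ?thesis using \<open>p > 0\<close> by (simp add: le_divide_eq)
      qed
      also have "real x / real (p\<^sup>2) + 4 * real x / real (p\<^sup>2) = 5 * real x * real p powr (-2)"
        using \<open>p > 0\<close> by (simp add: powr_minus powr_numeral field_simps)
      \<comment> \<open>The weaker exponent \<open>-3/2\<close> lets the tail bound for
        \<open>f\<close> serve here as well.\<close>
      also have "\<dots> \<le> 5 * real x * f p"
        using \<open>p > 0\<close> unfolding f_def by (intro mult_left_mono powr_mono) auto
      finally show "real (card (?m p)) \<le> 5 * real x * f p" by simp
    qed
    also have "\<dots> \<le> 5 * real x * \<eta>"
      unfolding sum_distrib_left[symmetric]
      by (intro mult_left_mono tail finT) (auto simp: T_def)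
    also have "\<dots> \<le> real x * (\<delta> / 2)"
      using mult_left_mono[OF \<eta>(1), of "real x"] by (simp add: algebra_simps)
    also have "real (card B) \<le> real x * (\<delta> / 2)"
    proof -
      \<comment> \<open>From \<open>4 * a < p\<^sup>2\<close> and
        \<open>p\<^sup>2 \<le> n + a\<close> follows \<open>3 * a < n\<close>, so all bad
        \<open>a\<close> are within the range of the sum \<open>W\<close>, however large
        \<open>x\<close> is.\<close>
      have B_sub: "B \<subseteq> {1..L}"
      proof
        fix a assume a: "a \<in> B"
        then obtain p where p: "4 * a < p\<^sup>2" "p\<^sup>2 dvd n + a" by (auto simp: B_def bad_def)
        have "p\<^sup>2 \<le> n + a" using p(2) a by (intro dvd_imp_le) (auto simp: B_def)
        then show "a \<in> {1..L}" using p(1) a \<open>n \<le> L\<close> by (auto simp: B_def)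
      qed
      \<comment> \<open>For \<open>a \<le> x\<close> the count \<open>1\<close> is at most
        \<open>x / a\<close>, which turns the single bound on \<open>W k\<close> into one for every
        \<open>x\<close>.\<close>
      have "real (card B) = (\<Sum>a\<in>B. 1)" by simp
      also have "\<dots> \<le> (\<Sum>a\<in>B. real x * (of_bool (bad n a) / real a))"
        by (intro sum_mono) (auto simp: B_def divide_simps)
      also have "\<dots> = real x * (\<Sum>a\<in>B. of_bool (bad n a) / real a)" by (simp add: sum_distrib_left)
      also have "\<dots> \<le> real x * W k"
        unfolding W_def n_def[symmetric] using B_sub by (intro mult_left_mono sum_mono2) auto
      also have "\<dots> \<le> real x * (\<delta> / 2)" using k(2) by (intro mult_left_mono) auto
      finally show ?thesis .
    qed
    finally show ?thesis by (simp add: mult.commute)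
  qed
  then show ?thesis using \<open>M > N\<^sub>0\<close> \<open>M \<le> n\<close> by (intro exI[of _ n]) auto
qed

section \<open>Proof of the two statements\<close>

lemma property_Pbar_imp_inf: "property_Pbar A \<Longrightarrow> property_Pbar_inf A"
proof -
  have "{n \<in> Npos. \<forall>a\<in>A. n + a \<in> SF} \<subseteq> {n \<in> Npos. finite {a \<in> A. n + a \<notin> SF}}"
    by (auto intro: finite_subset[of _ "{}"])
  then show "property_Pbar A \<Longrightarrow> property_Pbar_inf A"
    unfolding property_Pbar_def property_Pbar_inf_def by (rule infinite_super)
qed

lemma upper_density_less_if_Pbar_inf:
  assumes "property_Pbar_inf A"
  shows "upper_density A < ereal (6 / pi\<^sup>2)"
proof -
  define S where "S = {n \<in> Npos. finite {a \<in> A. n + a \<notin> SF}}"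
  have inf: "infinite S" using assms unfolding S_def property_Pbar_inf_def .
  then obtain m where m: "m \<in> S" using not_finite_existsD by fastforce
  obtain n where n: "n \<in> S" "n > m" using inf by (meson infinite_nat_iff_unbounded)
  define E where "E = {a \<in> A. m + a \<notin> SF} \<union> {a \<in> A. n + a \<notin> SF}"
  have finE: "finite E" using m n unfolding E_def S_def by auto
  obtain c K where c: "c < 6 / pi\<^sup>2" and
    K: "\<And>N. real (card {a \<in> {1..N}. squarefree (m + a) \<and> squarefree (n + a)}) \<le> c * real N + K"
    by (rule card_two_shifts_squarefree_le[OF n(2)]) (rule that)
  have "real (card (A \<inter> {1..N})) \<le> c * real N + (K + real (card E))" for N
  proof -
    let ?G = "{a \<in> {1..N}. squarefree (m + a) \<and> squarefree (n + a)}"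
    have "A \<inter> {1..N} \<subseteq> ?G \<union> E" by (auto simp: E_def SF_def)
    then have "card (A \<inter> {1..N}) \<le> card (?G \<union> E)" using finE by (intro card_mono) auto
    also have "\<dots> \<le> card ?G + card E" by (rule card_Un_le)
    finally show ?thesis using K[of N] by linarith
  qed
  moreover obtain c' where c': "c < c'" "c' < 6 / pi\<^sup>2" using dense[OF c] by blast
  ultimately have "upper_density A \<le> ereal c'" by (intro upper_density_le)
  also have "\<dots> < ereal (6 / pi\<^sup>2)" using c' by simp
  finally show ?thesis .
qed

lemma exists_dense_Pbar_set:
  fixes \<epsilon> :: real
  assumes "\<epsilon> > 0"
  shows "\<exists>A \<subseteq> Npos. property_Pbar A \<and> lower_density A \<ge> ereal (6 / pi\<^sup>2 - \<epsilon>)"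
proof -
  define \<delta> where "\<delta> i = \<epsilon> / 2 * (1 / 2) ^ Suc i" for i
  have \<delta>: "\<delta> i > 0" for i using assms by (simp add: \<delta>_def)
  have \<delta>_sums: "\<delta> sums (\<epsilon> / 2)"
    using sums_mult[OF power_half_series, of "\<epsilon> / 2"] by (simp only: \<delta>_def[abs_def] mult_1_right)
  obtain \<nu> where \<nu>: "\<And>i. \<nu> i > i" and
    count: "\<And>i x. real (card {a \<in> {1..x}. squarefree a \<and> \<not> squarefree (\<nu> i + a)}) \<le> \<delta> i * real x"
  proof -
    have "\<forall>i. \<exists>n>i. \<forall>x. real (card {a \<in> {1..x}. squarefree a \<and> \<not> squarefree (n + a)}) \<le> \<delta> i * real x"
      using exists_good_shift[OF \<delta>] by blast
    from choice[OF this] show ?thesis using that by blast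
  qed
  define A where "A = {a \<in> SF. \<forall>i. \<nu> i + a \<in> SF}"
  have "A \<subseteq> Npos" by (auto simp: A_def SF_def)
  \<comment> \<open>The bound \<open>\<nu> i > i\<close> makes the range unbounded even if \<nu>
    repeats values.\<close>
  have "infinite (range \<nu>)" using \<nu> by (auto simp: infinite_nat_iff_unbounded)
  moreover have "range \<nu> \<subseteq> {n \<in> Npos. \<forall>a\<in>A. n + a \<in> SF}"
    using le_less_trans[OF le0 \<nu>] by (auto simp: A_def Npos_def)
  ultimately have "property_Pbar A"
    unfolding property_Pbar_def by (rule infinite_super[rotated])
  obtain K where K: "\<And>N. real (card {a \<in> {1..N}. squarefree a}) \<ge> (6 / pi\<^sup>2 - \<epsilon> / 4) * real N - K"
    by (rule card_squarefree_ge[of "\<epsilon> / 4"]) (use assms in simp, rule that)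
  \<comment> \<open>The loss is \<epsilon> / 4 from counting squarefree numbers plus \<epsilon> / 2
    from all shifts together; the remaining \<epsilon> / 4 is the strict gap that
    \<open>lower_density_ge\<close> asks for.\<close>
  have "real (card (A \<inter> {1..N})) \<ge> (6 / pi\<^sup>2 - 3 * \<epsilon> / 4) * real N - K" for N
  proof -
    let ?S = "\<lambda>i. {a \<in> {1..N}. squarefree a \<and> \<not> squarefree (\<nu> i + a)}"
    define D where "D = {a \<in> {1..N}. squarefree a} - A"
    have "\<forall>a\<in>D. \<exists>i. a \<in> ?S i"
    proof
      fix a assume a: "a \<in> D"
      then have "a \<in> SF" by (auto simp: D_def SF_def Npos_def)
      then obtain i where "\<nu> i + a \<notin> SF" using a unfolding D_def A_def by blast
      then have "\<not> squarefree (\<nu> i + a)" using \<open>a \<in> SF\<close> by (simp add: SF_def Npos_def)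
      then show "\<exists>i. a \<in> ?S i" using a unfolding D_def by blast
    qed
    \<comment> \<open>One spoiling index is chosen for each lost \<open>a\<close>, so that for given
      \<open>N\<close> only finitely many shifts enter the union bound.\<close>
    from bchoice[OF this] obtain h where h: "\<forall>a\<in>D. a \<in> ?S (h a)" by blast
    have fin: "finite (h ` D)" by (simp add: D_def)
    have "D \<subseteq> (\<Union>i\<in>h ` D. ?S i)" using h by blast
    moreover have "finite (\<Union>i\<in>h ` D. ?S i)" using fin by (rule finite_UN_I) simp
    ultimately have "card D \<le> card (\<Union>i\<in>h ` D. ?S i)" by (intro card_mono)
    also have "\<dots> \<le> (\<Sum>i\<in>h ` D. card (?S i))" by (rule card_UN_le[OF fin])
    finally have "real (card D) \<le> (\<Sum>i\<in>h ` D. real (card (?S i)))" by (simp flip: of_nat_sum)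
    also have "\<dots> \<le> (\<Sum>i\<in>h ` D. \<delta> i * real N)" by (intro sum_mono count)
    also have "\<dots> = (\<Sum>i\<in>h ` D. \<delta> i) * real N" by (simp add: sum_distrib_right)
    also have "(\<Sum>i\<in>h ` D. \<delta> i) \<le> \<epsilon> / 2"
      unfolding sums_unique[OF \<delta>_sums]
      using \<delta> fin by (intro sum_le_suminf sums_summable[OF \<delta>_sums]) (auto intro: less_imp_le)
    finally have D: "real (card D) \<le> \<epsilon> / 2 * real N" by (simp add: mult_right_mono)
    have "{a \<in> {1..N}. squarefree a} \<subseteq> (A \<inter> {1..N}) \<union> D" by (auto simp: D_def)
    then have "card {a \<in> {1..N}. squarefree a} \<le> card ((A \<inter> {1..N}) \<union> D)"
      by (intro card_mono) (auto simp: D_def)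
    also have "\<dots> \<le> card (A \<inter> {1..N}) + card D" by (rule card_Un_le)
    finally show ?thesis using K[of N] D by (simp add: algebra_simps)
  qed
  then have "lower_density A \<ge> ereal (6 / pi\<^sup>2 - \<epsilon>)"
    using assms by (intro lower_density_ge) auto
  then show ?thesis using \<open>A \<subseteq> Npos\<close> \<open>property_Pbar A\<close> by blast
qed

theorem theorem1p9:
  shows "(\<forall>A \<subseteq> Npos. property_Pbar A \<or> property_Pbar_inf A \<longrightarrow>
            upper_density A < ereal (6 / pi\<^sup>2)) \<and>
         (\<forall>\<epsilon>::real. \<epsilon> > 0 \<longrightarrow>
            (\<exists>A \<subseteq> Npos. property_Pbar A \<and> property_Pbar_inf A \<and>
               ereal (6 / pi\<^sup>2 - \<epsilon>) \<le> lower_density A))"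
  using upper_density_less_if_Pbar_inf exists_dense_Pbar_set property_Pbar_imp_inf by meson

end
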